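(* Let $p\ge 3$ and let $q\ge 4$ be even. Then $C_p+_Q C_q$ is nearly dispersable, i.e. $\operatorname{mbt}(C_p+_Q C_q)=\Delta(C_p+_Q C_q)+1$; here $\Delta(C_p+_Q C_q)=4$, so $\operatorname{mbt}(C_p+_Q C_q)=5$.
   Context: $C_m$ denotes the cycle on $m$ vertices. Matching book embedding: the vertices are placed in a linear order along a spine and each edge is assigned to a page (half-plane bounded by the spine) so that no two edges on the same page cross and every vertex is incident with at most one edge on each page. $\operatorname{mbt}(G)$ is the minimum number of pages of a matching book embedding of $G$. $G$ is nearly dispersable if $\operatorname{mbt}(G)=\Delta(G)+1$, where $\Delta$ denotes maximum degree. For a graph $G$, $Q(G)$ is obtained by inserting a new vertex into each edge of $G$ and then joining two new vertices whenever their edges of $G$ share an endpoint; thus $V(Q(G))=V(G)\cup E(G)$. The $Q$-sum $G+_Q H$ has vertex set $(V(G)\cup E(G))\times V(H)$. Two vertices $(u_1,u_2)$ and $(v_1,v_2)$ are adjacent if and only if either $u_1=v_1\in V(G)$ and $u_2v_2\in E(H)$, or $u_2=v_2$ and $u_1v_1\in E(Q(G))$. *)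

theory Defs
  imports Main
begin

record 'a ugraph =
  verts :: "'a set"
  edges :: "'a set set"

definition simple_graph :: "'a ugraph \<Rightarrow> bool" where
  "simple_graph G \<longleftrightarrow>
     finite (verts G) \<and> (\<forall>e \<in> edges G. e \<subseteq> verts G \<and> card e = 2)"

definition degree :: "'a ugraph \<Rightarrow> 'a \<Rightarrow> nat" where
  "degree G v = card {e \<in> edges G. v \<in> e}"

definition max_degree :: "'a ugraph \<Rightarrow> nat" where
  "max_degree G = Max (degree G ` verts G)"

text \<open>Only meaningful as a cycle for \<open>m \<ge> 3\<close>.\<close>
definition cycle_graph :: "nat \<Rightarrow> nat ugraph" where
  "cycle_graph m =
     \<lparr> verts = {..<m}, edges = {{i, (i + 1) mod m} | i. i < m} \<rparr>"

text \<open>\<open>Inl v\<close> is the original vertex \<open>v\<close>; \<open>Inr e\<close> is the vertex inserted into the edge \<open>e\<close>.\<close>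
definition Q_graph :: "'a ugraph \<Rightarrow> ('a + 'a set) ugraph" where
  "Q_graph G =
     \<lparr> verts = Inl ` verts G \<union> Inr ` edges G,
       edges = {{Inl v, Inr e} | v e. e \<in> edges G \<and> v \<in> e}
             \<union> {{Inr e, Inr f} | e f.
                   e \<in> edges G \<and> f \<in> edges G \<and> e \<noteq> f \<and> e \<inter> f \<noteq> {}} \<rparr>"

definition Q_sum :: "'a ugraph \<Rightarrow> 'b ugraph \<Rightarrow> (('a + 'a set) \<times> 'b) ugraph" where
  "Q_sum G H =
     \<lparr> verts = verts (Q_graph G) \<times> verts H,
       edges = {{(u1, u2), (v1, v2)} | u1 u2 v1 v2.
                  (u1, u2) \<in> verts (Q_graph G) \<times> verts H \<and>
                  (v1, v2) \<in> verts (Q_graph G) \<times> verts H \<and>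
                  (u1 = v1 \<and> u1 \<in> Inl ` verts G \<and> {u2, v2} \<in> edges H \<or>
                   u2 = v2 \<and> {u1, v1} \<in> edges (Q_graph G))} \<rparr>"

text \<open>Two edges drawn in the same half-plane cross iff their endpoints strictly
  alternate along the spine.\<close>
definition crossing :: "('a \<Rightarrow> nat) \<Rightarrow> 'a set \<Rightarrow> 'a set \<Rightarrow> bool" where
  "crossing pos e f \<longleftrightarrow>
     (\<exists>a b c d. {e, f} = {{a, b}, {c, d}} \<and>
        pos a < pos c \<and> pos c < pos b \<and> pos b < pos d)"

text \<open>\<open>pos\<close> gives the position of each vertex on the spine, \<open>page\<close> the page of each edge;
  the pages are numbered \<open>0, \<dots>, n - 1\<close>.\<close>
definition matching_book_embedding ::
    "'a ugraph \<Rightarrow> nat \<Rightarrow> ('a \<Rightarrow> nat) \<Rightarrow> ('a set \<Rightarrow> nat) \<Rightarrow> bool" where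
  "matching_book_embedding G n pos page \<longleftrightarrow>
     bij_betw pos (verts G) {..<card (verts G)} \<and>
     (\<forall>e \<in> edges G. page e < n) \<and>
     (\<forall>e \<in> edges G. \<forall>f \<in> edges G. page e = page f \<longrightarrow> \<not> crossing pos e f) \<and>
     (\<forall>v \<in> verts G. \<forall>i < n. card {e \<in> edges G. v \<in> e \<and> page e = i} \<le> 1)"

definition mbt :: "'a ugraph \<Rightarrow> nat" where
  "mbt G = (LEAST n. \<exists>pos page. matching_book_embedding G n pos page)"

text \<open>The set over which \<^const>\<open>mbt\<close> minimises is nonempty for finite simple graphs.\<close>
lemma matching_book_embedding_exists:
  assumes "simple_graph G"
  shows "\<exists>n pos page. matching_book_embedding G n pos page"
proof -
  have fin: "finite (verts G)" and E: "edges G \<subseteq> Pow (verts G)"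
    using assms by (auto simp: simple_graph_def)
  have finE: "finite (edges G)" using fin E by (meson finite_Pow_iff finite_subset)
  obtain pos where pos: "bij_betw pos (verts G) {..<card (verts G)}"
    using ex_bij_betw_finite_nat[OF fin] by (auto simp: atLeast0LessThan)
  obtain page where page: "bij_betw page (edges G) {..<card (edges G)}"
    using ex_bij_betw_finite_nat[OF finE] by (auto simp: atLeast0LessThan)
  have inj: "e = f" if "e \<in> edges G" "f \<in> edges G" "page e = page f" for e f
    using page that by (auto simp: bij_betw_def inj_on_def)
  have nc: "\<not> crossing pos e e" for e
  proof
    assume "crossing pos e e"
    then obtain a b c d where eq: "{e, e} = {{a, b}, {c, d}}"
      and lt: "pos a < pos c" "pos c < pos b" "pos b < pos d"
      unfolding crossing_def by (elim exE conjE)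
    from eq have "{a, b} = {c, d}" by auto
    with lt show False by (auto simp: doubleton_eq_iff)
  qed
  have lt: "page e < card (edges G)" if "e \<in> edges G" for e
    using page that by (auto simp: bij_betw_def)
  have "card {e \<in> edges G. v \<in> e \<and> page e = i} \<le> 1" for v i
  proof -
    have "\<forall>e \<in> {e \<in> edges G. v \<in> e \<and> page e = i}.
          \<forall>f \<in> {e \<in> edges G. v \<in> e \<and> page e = i}. e = f"
      using inj by auto
    then show ?thesis
      using finE by (simp add: card_le_Suc0_iff_eq)
  qed
  then have "matching_book_embedding G (card (edges G)) pos page"
    unfolding matching_book_embedding_def
  proof (intro conjI ballI impI allI)
    fix e f
    assume "e \<in> edges G" "f \<in> edges G" "page e = page f"
    then have "e = f" by (rule inj)
    then show "\<not> crossing pos e f" by (simp add: nc)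
  qed (use pos lt in simp_all)
  then show ?thesis by (intro exI)
qed

definition nearly_dispersable :: "'a ugraph \<Rightarrow> bool" where
  "nearly_dispersable G \<longleftrightarrow> mbt G = max_degree G + 1"

lemma simple_graph_cycle_graph:
  assumes "m \<ge> 3"
  shows "simple_graph (cycle_graph m)"
proof -
  have "card {i, (i + 1) mod m} = 2" if "i < m" for i
    using assms that by (simp add: mod_Suc)
  then show ?thesis
    using assms by (auto simp: simple_graph_def cycle_graph_def)
qed

lemma simple_graph_Q_graph:
  assumes "simple_graph G"
  shows "simple_graph (Q_graph G)"
proof -
  have sub: "v \<in> verts G" if "e \<in> edges G" "v \<in> e" for v e
    using assms that by (auto simp: simple_graph_def)
  have "finite (verts G)" using assms by (simp add: simple_graph_def)
  moreover have "edges G \<subseteq> Pow (verts G)" using sub by blast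
  ultimately have "finite (verts (Q_graph G))"
    by (simp add: Q_graph_def finite_subset)
  moreover have "x \<subseteq> verts (Q_graph G) \<and> card x = 2" if "x \<in> edges (Q_graph G)" for x
  proof -
    consider v e where "x = {Inl v, Inr e}" "e \<in> edges G" "v \<in> e"
      | e f where "x = {Inr e, Inr f}" "e \<in> edges G" "f \<in> edges G" "e \<noteq> f"
      using \<open>x \<in> edges (Q_graph G)\<close> by (auto simp: Q_graph_def)
    then show ?thesis
      by cases (use sub in \<open>auto simp: Q_graph_def\<close>)
  qed
  ultimately show ?thesis by (simp add: simple_graph_def)
qed

lemma simple_graph_Q_sum:
  assumes "simple_graph G" "simple_graph H"
  shows "simple_graph (Q_sum G H)"
proof -
  have Q: "finite (verts (Q_graph G))" "\<And>x. {x} \<notin> edges (Q_graph G)"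
    using simple_graph_Q_graph[OF assms(1)] by (auto simp: simple_graph_def)
  have H: "finite (verts H)" "\<And>x. {x} \<notin> edges H"
    using assms(2) by (auto simp: simple_graph_def)
  have "x \<subseteq> verts (Q_sum G H) \<and> card x = 2" if "x \<in> edges (Q_sum G H)" for x
  proof -
    obtain u1 u2 v1 v2 where x: "x = {(u1, u2), (v1, v2)}"
      and V: "(u1, u2) \<in> verts (Q_sum G H)" "(v1, v2) \<in> verts (Q_sum G H)"
      and "u1 = v1 \<and> {u2, v2} \<in> edges H \<or> u2 = v2 \<and> {u1, v1} \<in> edges (Q_graph G)"
      using \<open>x \<in> edges (Q_sum G H)\<close> unfolding Q_sum_def by auto
    then have "(u1, u2) \<noteq> (v1, v2)" using Q(2) H(2) by auto
    then show ?thesis using x V by simp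
  qed
  moreover have "finite (verts (Q_sum G H))"
    using Q(1) H(1) by (simp add: Q_sum_def)
  ultimately show ?thesis by (simp add: simple_graph_def)
qed

end

theory Submission
  imports Defs
begin

text \<open>Lower bound: the graph is \<open>4\<close>-regular, so with four pages every page would be a perfect
  matching. The vertices strictly below an edge are matched among themselves, so every edge would
  join positions of different parity and the graph would be bipartite, but it contains triangles.
  Upper bound: place the layers one after the other, with odd layers reversed. The edges between
  consecutive layers are then nested, and since \<open>q\<close> is even, so are those closing the cycle; two
  pages hold all of them, together with most edges between the inserted vertices of a layer.
  Three more pages hold the remaining edges inside the layers.\<close>

section \<open>Pages as matchings and the parity obstruction\<close>

lemma degree_eq_sum_pages:
  fixes n :: nat
  assumes G: "simple_graph G" and page: "\<forall>e \<in> edges G. page e < n"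
  shows "degree G v = (\<Sum>i<n. card {e \<in> edges G. v \<in> e \<and> page e = i})"
proof -
  have "edges G \<subseteq> Pow (verts G)" "finite (verts G)"
    using G by (auto simp: simple_graph_def)
  then have fin: "finite (edges G)" by (meson finite_Pow_iff finite_subset)
  have "{e \<in> edges G. v \<in> e} = (\<Union>i\<in>{..<n}. {e \<in> edges G. v \<in> e \<and> page e = i})"
    using page by auto
  then have "degree G v = card (\<Union>i\<in>{..<n}. {e \<in> edges G. v \<in> e \<and> page e = i})"
    by (simp only: degree_def)
  also have "\<dots> = (\<Sum>i<n. card {e \<in> edges G. v \<in> e \<and> page e = i})"
    by (rule card_UN_disjoint) (use fin in auto)
  finally show ?thesis .
qed

lemma degree_le_pages:
  assumes "simple_graph G" "matching_book_embedding G n pos page" "v \<in> verts G"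
  shows "degree G v \<le> n"
proof -
  have "degree G v = (\<Sum>i<n. card {e \<in> edges G. v \<in> e \<and> page e = i})"
    using assms by (intro degree_eq_sum_pages) (auto simp: matching_book_embedding_def)
  also have "\<dots> \<le> (\<Sum>i<n. 1)"
    using assms by (intro sum_mono) (auto simp: matching_book_embedding_def)
  finally show ?thesis by simp
qed

text \<open>The degree is a sum of \<open>n\<close> page counts, none above 1, so reaching
  \<open>n\<close> forces every count to be exactly 1. Once this holds at all vertices, the pages
  are perfect matchings.\<close>

lemma full_degree_unique_page_edge:
  assumes "simple_graph G" and M: "matching_book_embedding G n pos page"
    and v: "v \<in> verts G" and deg: "degree G v = n" and i: "i < n"
  shows "\<exists>!e. e \<in> edges G \<and> v \<in> e \<and> page e = i"
proof -
  let ?c = "\<lambda>i. card {e \<in> edges G. v \<in> e \<and> page e = i}"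
  have le: "?c k \<le> 1" if "k < n" for k
    using M v that by (auto simp: matching_book_embedding_def)
  have "(\<Sum>k<n. ?c k) = (\<Sum>k<n. 1)"
    using degree_eq_sum_pages[of G page n v] assms by (simp add: matching_book_embedding_def)
  from sum_mono_inv[OF this, of i] have "?c i = 1" using le i by auto
  then obtain e where "{e \<in> edges G. v \<in> e \<and> page e = i} = {e}"
    by (auto simp: card_1_singleton_iff)
  then show ?thesis by (intro ex1I[of _ e]) auto
qed

lemma full_degree_edge_parity:
  assumes G: "simple_graph G" and M: "matching_book_embedding G n pos page"
    and deg: "\<And>v. v \<in> verts G \<Longrightarrow> degree G v = n"
    and uv: "{u, v} \<in> edges G"
  shows "even (pos u) \<noteq> even (pos v)"
proof -
  \<comment> \<open>Only the case of \<open>u\<close> left of \<open>v\<close> is argued; the other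
    one follows by exchanging the names.\<close>
  have *: "even (pos u) \<noteq> even (pos v)" if uv: "{u, v} \<in> edges G" and lt: "pos u < pos v" for u v
  proof -
    let ?i = "page {u, v}"
    have i: "?i < n" using M uv by (auto simp: matching_book_embedding_def)
    have V: "u \<in> verts G" "v \<in> verts G" and fin: "finite (verts G)"
      using G uv by (auto simp: simple_graph_def)
    have bij: "bij_betw pos (verts G) {..<card (verts G)}"
      using M by (auto simp: matching_book_embedding_def)
    then have inj: "inj_on pos (verts G)" by (simp add: bij_betw_def)
    note ex1 = full_degree_unique_page_edge[OF G M _ deg i]
    \<comment> \<open>\<open>S\<close> collects the vertices strictly under the arc,
      \<open>F\<close> the edges of its page that touch them. The aim is that \<open>F\<close>
      partitions \<open>S\<close> into pairs.\<close>
    define S where "S = {x \<in> verts G. pos u < pos x \<and> pos x < pos v}"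
    define F where "F = {e \<in> edges G. page e = ?i \<and> e \<inter> S \<noteq> {}}"
    \<comment> \<open>A page edge starting under the arc cannot end at \<open>u\<close> or
      \<open>v\<close>, whose only edge on this page is \<open>{u, v}\<close>, and cannot end beyond
      them without crossing the arc.\<close>
    have sub: "e \<subseteq> S" if "e \<in> F" for e
    proof
      fix y assume y: "y \<in> e"
      from that obtain x where e: "e \<in> edges G" "page e = ?i" and x: "x \<in> e" "x \<in> S"
        by (auto simp: F_def)
      show "y \<in> S"
      proof (cases "y = x")
        case False
        have "card e = 2" and eV: "e \<subseteq> verts G" using G e by (auto simp: simple_graph_def)
        then have exy: "e = {x, y}"
          using x y False by (auto simp: card_2_iff)
        have ne: "e \<noteq> {u, v}" using x by (auto simp: S_def)
        have "u \<notin> e" "v \<notin> e"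
          using ex1[OF V(1) V(1)] ex1[OF V(2) V(2)] uv e ne by blast+
        then have "y \<noteq> u" "y \<noteq> v" using y by auto
        then have d: "pos y \<noteq> pos u" "pos y \<noteq> pos v"
          using inj V eV y by (auto simp: inj_on_def)
        have "\<not> crossing pos {u, v} e" "\<not> crossing pos e {u, v}"
          using M uv e unfolding matching_book_embedding_def by auto
        moreover have "crossing pos {u, v} {x, y}" if "pos v < pos y"
          unfolding crossing_def
          by (rule exI[of _ u], rule exI[of _ v], rule exI[of _ x], rule exI[of _ y])
            (use x that in \<open>auto simp: S_def\<close>)
        moreover have "crossing pos {x, y} {u, v}" if "pos y < pos u"
          unfolding crossing_def
          by (rule exI[of _ y], rule exI[of _ x], rule exI[of _ u], rule exI[of _ v])
            (use x that in \<open>auto simp: S_def\<close>)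
        ultimately have "pos u < pos y" "pos y < pos v"
          using d exy by force+
        then show ?thesis using eV y by (auto simp: S_def)
      qed (use x in simp)
    qed
    have "S \<subseteq> \<Union> F"
    proof
      fix x assume x: "x \<in> S"
      then have "x \<in> verts G" by (simp add: S_def)
      from ex1[OF this this] obtain e where "e \<in> edges G" "x \<in> e" "page e = ?i" by blast
      then show "x \<in> \<Union> F" using x by (auto simp: F_def)
    qed
    with sub have "\<Union> F = S" by blast
    moreover have "pairwise disjnt F"
      unfolding pairwise_def disjnt_iff
    proof (intro ballI impI allI notI; elim conjE)
      fix e f x assume ef: "e \<in> F" "f \<in> F" "e \<noteq> f" and x: "x \<in> e" "x \<in> f"
      then have "x \<in> verts G" using sub by (auto simp: S_def)
      from ex1[OF this this] show False using ef x by (auto simp: F_def)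
    qed
    moreover have "finite e" if "e \<in> F" for e
      using sub[OF that] fin by (auto simp: S_def intro: finite_subset)
    ultimately have "card S = sum card F" by (metis card_Union_disjoint)
    also have "\<dots> = (\<Sum>e\<in>F. 2)"
      using G by (intro sum.cong) (auto simp: F_def simple_graph_def)
    finally have "even (card S)" by simp
    \<comment> \<open>Positions fill an initial segment of the naturals, so none between the two
      ends is vacant and \<open>card S\<close> is \<open>pos v - pos u - 1\<close>.\<close>
    moreover have "pos ` S = {pos u<..<pos v}"
    proof
      show "{pos u<..<pos v} \<subseteq> pos ` S"
      proof
        fix k assume k: "k \<in> {pos u<..<pos v}"
        have "pos v < card (verts G)" using bij V by (auto simp: bij_betw_def)
        then have "k \<in> pos ` verts G" using bij k by (auto simp: bij_betw_def)
        then show "k \<in> pos ` S" using k by (auto simp: S_def)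
      qed
    qed (auto simp: S_def)
    moreover have "card (pos ` S) = card S"
      using inj by (intro card_image) (auto simp: S_def inj_on_def)
    ultimately have "even (pos v - Suc (pos u))" by simp
    then show ?thesis using lt by (auto simp: Suc_le_eq)
  qed
  have "u \<noteq> v" "u \<in> verts G" "v \<in> verts G" using G uv by (auto simp: simple_graph_def)
  then have "pos u \<noteq> pos v"
    using M by (auto simp: matching_book_embedding_def bij_betw_def inj_on_def)
  then show ?thesis
    using *[OF uv] *[of v u] uv by (metis insert_commute linorder_neqE_nat)
qed

text \<open>If \<open>d = n\<close>, the parity of the position would be a proper 2-colouring, which
  a triangle does not admit.\<close>

lemma triangle_full_degree_less_pages:
  assumes G: "simple_graph G" and M: "matching_book_embedding G n pos page"
    and deg: "\<And>v. v \<in> verts G \<Longrightarrow> degree G v = d"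
    and E: "{x, y} \<in> edges G" "{y, z} \<in> edges G" "{x, z} \<in> edges G"
  shows "d < n"
proof -
  have "x \<in> verts G" using G E by (auto simp: simple_graph_def)
  then have "d \<le> n" using degree_le_pages[OF G M] deg by force
  moreover have "d \<noteq> n"
  proof
    assume "d = n"
    with deg have "\<And>v. v \<in> verts G \<Longrightarrow> degree G v = n" by simp
    from full_degree_edge_parity[OF G M this] E show False by blast
  qed
  ultimately show ?thesis by simp
qed

section \<open>Non-crossing arcs and a criterion for embeddings\<close>

text \<open>An arc is given by the positions of its ends in either order; two arcs coincide, lie
  side by side or are nested. All comparisons are strict, which also rules out distinct arcs with a
  common end, so one predicate expresses both the non-crossing and the matching condition.\<close>

definition arcs_compatible :: "nat \<Rightarrow> nat \<Rightarrow> nat \<Rightarrow> nat \<Rightarrow> bool" where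
  "arcs_compatible a b c d \<longleftrightarrow>
     a = c \<and> b = d \<or> a = d \<and> b = c \<or>
     max a b < min c d \<or> max c d < min a b \<or>
     min c d < min a b \<and> max a b < max c d \<or> min a b < min c d \<and> max c d < max a b"

lemma arcs_compatible_sym: "arcs_compatible a b c d \<Longrightarrow> arcs_compatible c d a b"
  unfolding arcs_compatible_def by blast

text \<open>Each of \<open>a\<close> and \<open>b\<close> is left or right of the whole span of
  \<open>c\<close> and \<open>d\<close>. On the same side the arcs are separated, on opposite sides
  the first encloses the second.\<close>

lemma arcs_compatible_outside:
  assumes "\<not> (min c d \<le> a \<and> a \<le> max c d)" "\<not> (min c d \<le> b \<and> b \<le> max c d)"
  shows "arcs_compatible a b c d"
  using assms unfolding arcs_compatible_def by (auto simp: not_le)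

text \<open>Made for rainbows, where right ends come in the reverse order of left ends. The two
  equivalences force equal right ends when the left ends agree, so an arc may be compared with
  itself. The second conclusion serves arcs listed from right to left.\<close>

lemma arcs_compatible_nested:
  assumes "a < b" "c < d" "a < d" "c < b" "(a < c) = (d < b)" "(c < a) = (b < d)"
  shows "arcs_compatible a b c d" "arcs_compatible b a d c"
  using assms unfolding arcs_compatible_def by auto

lemma arcs_compatible_not_crossing:
  assumes "arcs_compatible (pos x) (pos y) (pos z) (pos w)"
  shows "\<not> crossing pos {x, y} {z, w}"
proof
  assume "crossing pos {x, y} {z, w}"
  then obtain a b c d where eq: "{{x, y}, {z, w}} = {{a, b}, {c, d}}"
    and "pos a < pos c" "pos c < pos b" "pos b < pos d"
    unfolding crossing_def by (elim exE conjE)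
  moreover from eq have "{x, y} = {a, b} \<and> {z, w} = {c, d} \<or> {x, y} = {c, d} \<and> {z, w} = {a, b}"
    by (simp add: doubleton_eq_iff)
  ultimately show False
    using assms by (auto simp: arcs_compatible_def doubleton_eq_iff)
qed

text \<open>The families \<open>P i\<close> need only cover the edges: each edge picks one page that
  contains it. A single pairwise condition suffices, because compatible arcs that share an end
  coincide and \<open>pos\<close> is injective.\<close>

lemma matching_book_embeddingI:
  assumes G: "simple_graph G" and bij: "bij_betw pos (verts G) {..<card (verts G)}"
    and cover: "\<And>e. e \<in> edges G \<Longrightarrow> \<exists>i<n. \<exists>(x, y)\<in>P i. e = {x, y}"
    and compat: "\<And>i x y z w. i < n \<Longrightarrow> (x, y) \<in> P i \<Longrightarrow> (z, w) \<in> P i \<Longrightarrow>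
      arcs_compatible (pos x) (pos y) (pos z) (pos w)"
  shows "\<exists>page. matching_book_embedding G n pos page"
proof -
  have "\<forall>e\<in>edges G. \<exists>i. i < n \<and> (\<exists>(x, y)\<in>P i. e = {x, y})"
    using cover by blast
  from bchoice[OF this] obtain page where
    page: "\<And>e. e \<in> edges G \<Longrightarrow> page e < n"
    and P: "\<And>e. e \<in> edges G \<Longrightarrow> \<exists>(x, y)\<in>P (page e). e = {x, y}"
    by blast
  have pair: "\<not> crossing pos e f \<and> (e \<inter> f \<noteq> {} \<longrightarrow> e = f)"
    if ef: "e \<in> edges G" "f \<in> edges G" and eq: "page e = page f" for e f
  proof -
    from P[OF ef(1)] obtain x y where xy: "(x, y) \<in> P (page e)" "e = {x, y}" by blast
    from P[OF ef(2)] obtain z w where zw: "(z, w) \<in> P (page e)" "f = {z, w}" unfolding eq by blast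
    have c: "arcs_compatible (pos x) (pos y) (pos z) (pos w)"
      using compat[OF page[OF ef(1)] xy(1) zw(1)] .
    have "inj_on pos (verts G)" "{x, y, z, w} \<subseteq> verts G"
      using bij G ef xy zw by (auto simp: bij_betw_def simple_graph_def)
    then have "inj_on pos {x, y, z, w}" by (rule inj_on_subset)
    then have "e = f" if "e \<inter> f \<noteq> {}"
      using c that unfolding xy zw arcs_compatible_def by (auto simp: inj_on_def)
    moreover have "\<not> crossing pos e f"
      unfolding xy zw using c by (rule arcs_compatible_not_crossing)
    ultimately show ?thesis by blast
  qed
  have "edges G \<subseteq> Pow (verts G)" "finite (verts G)"
    using G by (auto simp: simple_graph_def)
  then have fin: "finite (edges G)" by (meson finite_Pow_iff finite_subset)
  have "card {e \<in> edges G. v \<in> e \<and> page e = i} \<le> 1" for v i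
    using fin pair by (auto simp: card_le_Suc0_iff_eq)
  then have "matching_book_embedding G n pos page"
    unfolding matching_book_embedding_def using bij page pair by blast
  then show ?thesis by blast
qed

section \<open>Spine order of the layers\<close>

text \<open>\<open>j\<close> is the layer, \<open>m\<close> its size and \<open>k\<close> the place
  within it. Layers of different parity run in opposite directions, so the copies of one place in
  them are mirror images and the arcs joining copies nest.\<close>

definition snake :: "nat \<Rightarrow> nat \<Rightarrow> nat \<Rightarrow> nat" where
  "snake m j k = m * j + (if even j then k else m - 1 - k)"

lemma snake_bounds:
  assumes "k < m"
  shows "m * j \<le> snake m j k" "snake m j k < m * (j + 1)"
  using assms by (auto simp: snake_def)

lemma snake_layer_less:
  assumes "j < j'" "k < m" "k' < m"
  shows "snake m j k < snake m j' k'"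
proof -
  have "m * (j + 1) \<le> m * j'" using assms by (intro mult_le_mono) auto
  then show ?thesis using snake_bounds[OF assms(2), of j] snake_bounds[OF assms(3), of j'] by linarith
qed

lemma snake_same_layer:
  assumes "k < m" "k' < m"
  shows "snake m j k < snake m j k' \<longleftrightarrow> (if even j then k < k' else k' < k)"
    and "snake m j k = snake m j k' \<longleftrightarrow> k = k'"
  using assms by (auto simp: snake_def)

lemma snake_eq_iff:
  assumes "k < m" "k' < m"
  shows "snake m j k = snake m j' k' \<longleftrightarrow> j = j' \<and> k = k'"
  using snake_same_layer[OF assms] snake_layer_less[of j j', OF _ assms]
    snake_layer_less[of j' j, OF _ assms(2,1)]
  by (metis less_irrefl linorder_neqE_nat)

text \<open>Distinct layers occupy disjoint blocks, and within one layer the numbering is monotone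
  or reversed, both of which preserve compatibility. Hence arcs inside layers need only be compared
  by place.\<close>

lemma arcs_compatible_snake_intra:
  assumes lt: "a < m" "b < m" "c < m" "d < m"
    and c: "arcs_compatible a b c d"
  shows "arcs_compatible (snake m j a) (snake m j b) (snake m j' c) (snake m j' d)"
proof -
  consider "j < j'" | "j' < j" | "j = j'" by linarith
  then show ?thesis
  proof cases
    case 1
    show ?thesis
      using snake_layer_less[OF 1 lt(1) lt(3)] snake_layer_less[OF 1 lt(2) lt(3)]
        snake_layer_less[OF 1 lt(1) lt(4)] snake_layer_less[OF 1 lt(2) lt(4)]
      unfolding arcs_compatible_def by simp
  next
    case 2
    show ?thesis
      using snake_layer_less[OF 2 lt(3) lt(1)] snake_layer_less[OF 2 lt(3) lt(2)]
        snake_layer_less[OF 2 lt(4) lt(1)] snake_layer_less[OF 2 lt(4) lt(2)]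
      unfolding arcs_compatible_def by simp
  next
    case 3
    define f where "f = snake m j"
    have less: "f x < f y \<longleftrightarrow> (if even j then x < y else y < x)"
      and eq: "f x = f y \<longleftrightarrow> x = y" if "x < m" "y < m" for x y
      using snake_same_layer[OF that] by (simp_all add: f_def)
    \<comment> \<open>In a reversed layer minimum and maximum trade places, which turns each
      alternative of the definition into another one.\<close>
    have minmax: "min (f x) (f y) = (if even j then f (min x y) else f (max x y))"
      "max (f x) (f y) = (if even j then f (max x y) else f (min x y))" if "x < m" "y < m" for x y
      using less[OF that] less[OF that(2,1)] eq[OF that]
      by (cases x y rule: linorder_cases; simp add: min_def max_def not_le)+
    define A B C D where ABCD: "A = min a b" "B = max a b" "C = min c d" "D = max c d"
    have ABCD_lt: "A < m" "B < m" "C < m" "D < m" using lt by (auto simp: ABCD)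
    have "a = c \<and> b = d \<or> a = d \<and> b = c \<or> B < C \<or> D < A \<or> C < A \<and> B < D \<or> A < C \<and> D < B"
      using c unfolding arcs_compatible_def ABCD .
    then have "arcs_compatible (f a) (f b) (f c) (f d)"
      unfolding arcs_compatible_def minmax[OF lt(1,2)] minmax[OF lt(3,4)] ABCD[symmetric]
      by (cases "even j") (auto simp: less eq lt ABCD_lt)
    then show ?thesis by (simp add: f_def 3)
  qed
qed

text \<open>Both ends of the first arc sit at place \<open>k\<close>. In layer \<open>j\<close> this
  place is outside the span of \<open>a\<close> and \<open>b\<close>, with or without reversal, and
  in any other layer it is outside the whole block.\<close>

lemma arcs_compatible_snake_inter_intra:
  assumes lt: "k < m" "a < m" "b < m"
    and out: "\<not> (min a b \<le> k \<and> k \<le> max a b)"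
  shows "arcs_compatible (snake m i k) (snake m i' k) (snake m j a) (snake m j b)"
proof -
  have "\<not> (min (snake m j a) (snake m j b) \<le> snake m i k \<and>
          snake m i k \<le> max (snake m j a) (snake m j b))" for i
  proof -
    consider "i < j" | "j < i" | "i = j" by linarith
    then show ?thesis
    proof cases
      case 1
      show ?thesis using snake_layer_less[OF 1 lt(1) lt(2)] snake_layer_less[OF 1 lt(1) lt(3)]
        by linarith
    next
      case 2
      show ?thesis using snake_layer_less[OF 2 lt(2) lt(1)] snake_layer_less[OF 2 lt(3) lt(1)]
        by linarith
    next
      case 3
      show ?thesis using out lt unfolding 3 snake_def by (cases "even j") (simp_all, linarith+)
    qed
  qed
  then show ?thesis by (intro arcs_compatible_outside)
qed

text \<open>Arcs leaving the same layer form a rainbow between two oppositely directed layers. Arcs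
  leaving different layers of equal parity use disjoint pairs of layers, so they are side by side,
  except that the arcs closing the cycle enclose the others.\<close>

lemma arcs_compatible_snake_inter:
  assumes q: "even q" "j < q" "j' < q" and par: "even j = even j'"
    and lt: "k < m" "k' < m"
  shows "arcs_compatible (snake m j k) (snake m ((j + 1) mod q) k)
           (snake m j' k') (snake m ((j' + 1) mod q) k')"
proof -
  have *: "arcs_compatible (snake m j k) (snake m ((j + 1) mod q) k)
           (snake m j' k') (snake m ((j' + 1) mod q) k')"
    if "j < j'" and q': "j' < q" and par: "even j = even j'" and lt: "k < m" "k' < m" for j j' k k'
  proof -
    \<comment> \<open>Equal parity leaves a gap: layers \<open>j\<close> and \<open>j + 1\<close>
      both precede layer \<open>j'\<close>.\<close>
    have "j + 1 \<noteq> j'" using par by auto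
    then have j: "j + 1 < j'" "(j + 1) mod q = j + 1" using that by auto
    note l = snake_layer_less[OF _ lt] snake_layer_less[OF _ lt(2,1)]
      snake_layer_less[OF _ lt(1) lt(1)] snake_layer_less[OF _ lt(2) lt(2)]
    have 1: "snake m j k < snake m (j + 1) k" "snake m (j + 1) k < snake m j' k'"
      using l(3)[of j "j + 1"] l(1)[OF j(1)] by simp_all
    show ?thesis
    proof (cases "j' + 1 = q")
      case True
      \<comment> \<open>The second arc returns from layer \<open>q - 1\<close> to layer 0. Since
        \<open>q\<close> is even, \<open>j'\<close> is odd and so is \<open>j\<close>; layer 0 thus
        lies left of the first arc, which is enclosed.\<close>
      then have "0 < j" using par q by (cases j) auto
      then have "snake m 0 k' < snake m j k" using l(2) by blast
      then show ?thesis using 1 True j(2) unfolding arcs_compatible_def by simp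
    next
      case False
      then have "(j' + 1) mod q = j' + 1" using q' by simp
      moreover have "snake m j' k' < snake m (j' + 1) k'" using l(4)[of j' "j' + 1"] by simp
      ultimately show ?thesis using 1 j(2) unfolding arcs_compatible_def by simp
    qed
  qed
  consider "j < j'" | "j' < j" | "j = j'" by linarith
  then show ?thesis
  proof cases
    case 1
    from *[OF this q(3) par lt] show ?thesis .
  next
    case 2
    show ?thesis
      by (rule arcs_compatible_sym[OF *[OF 2 q(2) par[symmetric] lt(2,1)]])
  next
    case 3
    let ?J = "(j + 1) mod q"
    \<comment> \<open>This includes the wrap-around, from the odd layer \<open>q - 1\<close> to the
      even layer 0, so the two layers always run in opposite directions.\<close>
    have J: "even ?J \<noteq> even j" using q by (cases "j + 1 = q") auto
    then have "j \<noteq> ?J" by metis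
    then consider "j < ?J" | "?J < j" by linarith
    then show ?thesis
    proof cases
      case 1
      show ?thesis unfolding 3[symmetric]
        by (rule arcs_compatible_nested(1)) (use J lt 1 in \<open>simp_all add: snake_layer_less snake_same_layer\<close>)
    next
      case 2
      show ?thesis unfolding 3[symmetric]
        by (rule arcs_compatible_nested(2)) (use J lt 2 in \<open>simp_all add: snake_layer_less snake_same_layer\<close>)
    qed
  qed
qed

section \<open>Vertices and edges of the \<open>Q\<close>-sum by indices\<close>

definition cycle_edge :: "nat \<Rightarrow> nat \<Rightarrow> nat set" where
  "cycle_edge p i = {i, (i + 1) mod p}"

lemma edges_cycle_graph: "edges (cycle_graph p) = cycle_edge p ` {..<p}"
  by (auto simp: cycle_graph_def cycle_edge_def)

text \<open>With \<open>p = 2\<close> the edges 0 and 1 would be the same set. From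
  \<open>p = 3\<close> on, the index is a faithful name for the inserted vertex.\<close>

lemma cycle_edge_eq_iff:
  assumes "p \<ge> 3" "i < p" "i' < p"
  shows "cycle_edge p i = cycle_edge p i' \<longleftrightarrow> i = i'"
  using assms by (auto simp: cycle_edge_def doubleton_eq_iff mod_Suc split: if_splits)

lemma cycle_edge_inter_iff:
  assumes "p \<ge> 3" "i < p" "i' < p"
  shows "cycle_edge p i \<inter> cycle_edge p i' \<noteq> {} \<longleftrightarrow>
    i = i' \<or> i' = (i + 1) mod p \<or> i = (i' + 1) mod p"
  using assms by (auto simp: cycle_edge_def mod_Suc split: if_splits)

definition orig_vertex :: "nat \<Rightarrow> nat \<Rightarrow> (nat + nat set) \<times> nat" where
  "orig_vertex i j = (Inl i, j)"

definition edge_vertex :: "nat \<Rightarrow> nat \<Rightarrow> nat \<Rightarrow> (nat + nat set) \<times> nat" where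
  "edge_vertex p i j = (Inr (cycle_edge p i), j)"

lemma vertex_eq_simps:
  "orig_vertex i j = orig_vertex i' j' \<longleftrightarrow> i = i' \<and> j = j'"
  "orig_vertex i j \<noteq> edge_vertex p i' j'" "edge_vertex p i' j' \<noteq> orig_vertex i j"
  by (auto simp: orig_vertex_def edge_vertex_def)

lemma edge_vertex_eq_iff:
  assumes "p \<ge> 3" "i < p" "i' < p"
  shows "edge_vertex p i j = edge_vertex p i' j' \<longleftrightarrow> i = i' \<and> j = j'"
  using cycle_edge_eq_iff[OF assms] by (auto simp: edge_vertex_def)

lemma verts_Q_sum_cycles:
  "verts (Q_sum (cycle_graph p) (cycle_graph q)) =
     {orig_vertex i j | i j. i < p \<and> j < q} \<union> {edge_vertex p i j | i j. i < p \<and> j < q}"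
proof -
  have "verts (Q_graph (cycle_graph p)) = Inl ` {..<p} \<union> (Inr \<circ> cycle_edge p) ` {..<p}"
    by (simp add: Q_graph_def edges_cycle_graph image_comp) (simp add: cycle_graph_def)
  then show ?thesis
    by (auto simp: Q_sum_def orig_vertex_def edge_vertex_def cycle_graph_def)
qed

text \<open>The families are the copies of \<open>C_q\<close> over original vertices, the two halves
  of each subdivided edge, and the links between inserted vertices of consecutive edges.\<close>

lemma edges_Q_sum_cycles:
  assumes p: "p \<ge> 3" and q: "q \<ge> 3"
  shows "edges (Q_sum (cycle_graph p) (cycle_graph q)) =
     {{orig_vertex i j, orig_vertex i ((j + 1) mod q)} | i j. i < p \<and> j < q} \<union>
     {{orig_vertex i j, edge_vertex p i j} | i j. i < p \<and> j < q} \<union>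
     {{orig_vertex ((i + 1) mod p) j, edge_vertex p i j} | i j. i < p \<and> j < q} \<union>
     {{edge_vertex p i j, edge_vertex p ((i + 1) mod p) j} | i j. i < p \<and> j < q}"
    (is "?E = ?E1 \<union> ?E2 \<union> ?E3 \<union> ?E4")
proof -
  let ?Q = "Q_graph (cycle_graph p)"
  have image_Collect: "{g v e | v e. e \<in> h ` A \<and> P v e} = {g v (h i) | v i. i \<in> A \<and> P v (h i)}"
      "{k e f | e f. e \<in> h ` A \<and> f \<in> h ` A \<and> R e f} =
       {k (h i) (h i') | i i'. i \<in> A \<and> i' \<in> A \<and> R (h i) (h i')}"
    for g :: "nat \<Rightarrow> nat set \<Rightarrow> (nat + nat set) set" and k :: "nat set \<Rightarrow> nat set \<Rightarrow> (nat + nat set) set"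
      and h A P R
    by blast+
  have EQ: "edges ?Q = {{Inl v, Inr (cycle_edge p i)} | v i. i \<in> {..<p} \<and> v \<in> cycle_edge p i} \<union>
      {{Inr (cycle_edge p i), Inr (cycle_edge p i')} | i i'. i \<in> {..<p} \<and> i' \<in> {..<p} \<and>
         cycle_edge p i \<noteq> cycle_edge p i' \<and> cycle_edge p i \<inter> cycle_edge p i' \<noteq> {}}"
    unfolding Q_graph_def edges_cycle_graph ugraph.simps image_Collect(1) image_Collect(2) ..
  note EQ = EQ[unfolded lessThan_iff]
  have simple: "simple_graph ?Q"
    using p by (intro simple_graph_Q_graph simple_graph_cycle_graph)
  \<comment> \<open>The vertex-set conditions in \<open>Q_sum\<close> follow from simplicity of
    \<open>C_q\<close> and of \<open>Q(C_p)\<close>, apart from the bound on the shared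
    coordinate.\<close>
  have mem: "e \<in> ?E \<longleftrightarrow>
      (\<exists>i u2 v2. e = {(Inl i, u2), (Inl i, v2)} \<and> i < p \<and> {u2, v2} \<in> edges (cycle_graph q)) \<or>
      (\<exists>u1 v1 j. e = {(u1, j), (v1, j)} \<and> j < q \<and> {u1, v1} \<in> edges ?Q)" for e
  proof
    assume "e \<in> ?E"
    then show "(\<exists>i u2 v2. e = {(Inl i, u2), (Inl i, v2)} \<and> i < p \<and> {u2, v2} \<in> edges (cycle_graph q)) \<or>
      (\<exists>u1 v1 j. e = {(u1, j), (v1, j)} \<and> j < q \<and> {u1, v1} \<in> edges ?Q)"
      unfolding Q_sum_def by (auto simp: cycle_graph_def)
  next
    have 1: "{u2, v2} \<in> edges (cycle_graph q) \<Longrightarrow> u2 < q \<and> v2 < q" for u2 v2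
      using simple_graph_cycle_graph[OF q] by (auto simp: simple_graph_def cycle_graph_def)
    have 2: "{u1, v1} \<in> edges ?Q \<Longrightarrow> u1 \<in> verts ?Q \<and> v1 \<in> verts ?Q" for u1 v1
      using simple by (auto simp: simple_graph_def)
    assume "(\<exists>i u2 v2. e = {(Inl i, u2), (Inl i, v2)} \<and> i < p \<and> {u2, v2} \<in> edges (cycle_graph q)) \<or>
      (\<exists>u1 v1 j. e = {(u1, j), (v1, j)} \<and> j < q \<and> {u1, v1} \<in> edges ?Q)"
    then show "e \<in> ?E"
    proof (elim disjE exE conjE)
      fix i u2 v2 assume "e = {(Inl i, u2), (Inl i, v2)}" "i < p" "{u2, v2} \<in> edges (cycle_graph q)"
      moreover from this 1 have "u2 < q" "v2 < q" by auto
      moreover have "Inl i \<in> verts ?Q" using \<open>i < p\<close> by (simp add: Q_graph_def cycle_graph_def)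
      moreover have "Inl i \<in> Inl ` verts (cycle_graph p)" using \<open>i < p\<close> by (simp add: cycle_graph_def)
      moreover have "verts (cycle_graph q) = {..<q}" by (simp add: cycle_graph_def)
      ultimately show ?thesis unfolding Q_sum_def by auto
    next
      fix u1 v1 j assume "e = {(u1, j), (v1, j)}" "j < q" "{u1, v1} \<in> edges ?Q"
      moreover from this 2 have "u1 \<in> verts ?Q" "v1 \<in> verts ?Q" by auto
      moreover have "verts (cycle_graph q) = {..<q}" by (simp add: cycle_graph_def)
      ultimately show ?thesis unfolding Q_sum_def by auto
    qed
  qed
  show ?thesis
  proof (intro equalityI subsetI)
    fix e assume "e \<in> ?E"
    then consider
      (a) i u2 v2 where "e = {(Inl i, u2), (Inl i, v2)}" "i < p" "{u2, v2} \<in> edges (cycle_graph q)"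
      | (b) u1 v1 j where "e = {(u1, j), (v1, j)}" "j < q" "{u1, v1} \<in> edges ?Q"
      unfolding mem by blast
    then show "e \<in> ?E1 \<union> ?E2 \<union> ?E3 \<union> ?E4"
    proof cases
      case a
      then obtain j where "j < q" "{u2, v2} = {j, (j + 1) mod q}"
        by (auto simp: cycle_graph_def)
      then have "e = {orig_vertex i j, orig_vertex i ((j + 1) mod q)}"
        using a(1) by (auto simp: orig_vertex_def doubleton_eq_iff)
      then show ?thesis using a \<open>j < q\<close> by blast
    next
      case b
      from b(3) consider
        (c) v i where "{u1, v1} = {Inl v, Inr (cycle_edge p i)}" "i < p" "v \<in> cycle_edge p i"
        | (d) i i' where "{u1, v1} = {Inr (cycle_edge p i), Inr (cycle_edge p i')}" "i < p" "i' < p"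
            "cycle_edge p i \<noteq> cycle_edge p i'" "cycle_edge p i \<inter> cycle_edge p i' \<noteq> {}"
        unfolding EQ by blast
      then show ?thesis
      proof cases
        case c
        then have "e = {orig_vertex v j, edge_vertex p i j}"
          using b(1) by (auto simp: orig_vertex_def edge_vertex_def doubleton_eq_iff)
        then show ?thesis using c b(2) unfolding cycle_edge_def by blast
      next
        case d
        then have e: "e = {edge_vertex p i j, edge_vertex p i' j}"
          using b(1) by (auto simp: edge_vertex_def doubleton_eq_iff)
        \<comment> \<open>Two distinct edges of a cycle meet only if one is the successor of the
          other; as the pair is unordered, both directions fall into the last family.\<close>
        have "i' = (i + 1) mod p \<or> i = (i' + 1) mod p"
          using d cycle_edge_inter_iff[OF p d(2,3)] by blast
        then show ?thesis using e d(2,3) b(2) by (blast intro: insert_commute)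
      qed
    qed
  next
    fix e assume "e \<in> ?E1 \<union> ?E2 \<union> ?E3 \<union> ?E4"
    then show "e \<in> ?E"
    proof (elim UnE)
      assume "e \<in> ?E1"
      then show ?thesis unfolding mem
        by (auto simp: orig_vertex_def cycle_graph_def)
    next
      assume "e \<in> ?E2"
      then obtain i j where e: "e = {(Inl i, j), (Inr (cycle_edge p i), j)}" "i < p" "j < q"
        by (auto simp: orig_vertex_def edge_vertex_def)
      have "i \<in> cycle_edge p i" by (simp add: cycle_edge_def)
      then have "{Inl i, Inr (cycle_edge p i)} \<in> edges ?Q" using e unfolding EQ by blast
      then show ?thesis unfolding mem using e by blast
    next
      assume "e \<in> ?E3"
      then obtain i j where e: "e = {(Inl ((i + 1) mod p), j), (Inr (cycle_edge p i), j)}" "i < p" "j < q"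
        by (auto simp: orig_vertex_def edge_vertex_def)
      have "(i + 1) mod p \<in> cycle_edge p i" by (simp add: cycle_edge_def)
      then have "{Inl ((i + 1) mod p), Inr (cycle_edge p i)} \<in> edges ?Q" using e unfolding EQ by blast
      then show ?thesis unfolding mem using e by blast
    next
      assume "e \<in> ?E4"
      then obtain i j where e: "e = {(Inr (cycle_edge p i), j), (Inr (cycle_edge p ((i + 1) mod p)), j)}" "i < p" "j < q"
        by (auto simp: edge_vertex_def)
      have i: "(i + 1) mod p < p" "i \<noteq> (i + 1) mod p" using p e(2) by (auto simp: mod_Suc)
      then have "cycle_edge p i \<inter> cycle_edge p ((i + 1) mod p) \<noteq> {}"
        using cycle_edge_inter_iff[OF p e(2) i(1)] by blast
      then have "{Inr (cycle_edge p i), Inr (cycle_edge p ((i + 1) mod p))} \<in> edges ?Q"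
        using e i cycle_edge_eq_iff[OF p e(2) i(1)] unfolding EQ by blast
      then show ?thesis unfolding mem using e by blast
    qed
  qed
qed

section \<open>Regularity of degree 4\<close>

lemma degree_eq_card_neighbours:
  assumes G: "simple_graph G"
  shows "degree G v = card {x. {v, x} \<in> edges G}"
proof -
  have "{e \<in> edges G. v \<in> e} = (\<lambda>x. {v, x}) ` {x. {v, x} \<in> edges G}"
  proof (intro equalityI subsetI)
    fix e assume e: "e \<in> {e \<in> edges G. v \<in> e}"
    then have "card e = 2" using G by (auto simp: simple_graph_def)
    then obtain a b where "e = {a, b}" by (auto simp: card_2_iff)
    then have "e = {v, a} \<or> e = {v, b}" using e by auto
    then show "e \<in> (\<lambda>x. {v, x}) ` {x. {v, x} \<in> edges G}" using e by auto
  qed auto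
  moreover have "inj_on (\<lambda>x. {v, x}) A" for A
    by (auto simp: inj_on_def doubleton_eq_iff)
  ultimately show ?thesis by (simp add: degree_def card_image)
qed

text \<open>Inverse of the cyclic successor on indices below \<open>p\<close>; the case split is
  there because subtraction truncates at 0.\<close>

definition cycle_pred :: "nat \<Rightarrow> nat \<Rightarrow> nat" where
  "cycle_pred p i = (if i = 0 then p - 1 else i - 1)"

lemma cycle_succ_eq_iff:
  assumes "i < p" "i' < p"
  shows "(i' + 1) mod p = i \<longleftrightarrow> i' = cycle_pred p i"
  using assms by (auto simp: cycle_pred_def mod_Suc)

lemma cycle_pred_succ: "i < p \<Longrightarrow> cycle_pred p (Suc i mod p) = i"
  by (auto simp: cycle_pred_def mod_Suc)

lemma cycle_pred_less: "i < p \<Longrightarrow> cycle_pred p i < p"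
  by (auto simp: cycle_pred_def)

text \<open>On a cycle of length 2 successor and predecessor would agree. Their distinctness gives
  the neighbour lists four elements.\<close>

lemma cycle_succ_neq_pred:
  assumes "p \<ge> 3" "i < p"
  shows "(i + 1) mod p \<noteq> cycle_pred p i" "(i + 1) mod p \<noteq> i" "cycle_pred p i \<noteq> i"
  using assms by (auto simp: cycle_pred_def mod_Suc)

text \<open>An original vertex has two neighbours in its copy of \<open>C_q\<close> and two inserted
  ones in its layer; an inserted vertex has the two ends of its edge and the inserted vertices of
  the two adjacent edges.\<close>

lemma degree_Q_sum_cycles:
  assumes p: "p \<ge> 3" and q: "q \<ge> 3"
    and v: "v \<in> verts (Q_sum (cycle_graph p) (cycle_graph q))"
  shows "degree (Q_sum (cycle_graph p) (cycle_graph q)) v = 4"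
proof -
  let ?G = "Q_sum (cycle_graph p) (cycle_graph q)"
  have simple: "simple_graph ?G"
    using p q by (intro simple_graph_Q_sum simple_graph_cycle_graph)
  note E = edges_Q_sum_cycles[OF p q]
  have s: "(i + 1) mod p < p" "(j + 1) mod q < q" for i j using p q by auto
  from v consider (orig) i j where "v = orig_vertex i j" "i < p" "j < q"
    | (edge) i j where "v = edge_vertex p i j" "i < p" "j < q"
    unfolding verts_Q_sum_cycles by blast
  then show ?thesis
  proof cases
    case orig
    note ij = orig(2,3)
    let ?N = "{orig_vertex i ((j + 1) mod q), orig_vertex i (cycle_pred q j),
               edge_vertex p i j, edge_vertex p (cycle_pred p i) j}"
    have "{x. {v, x} \<in> edges ?G} = ?N"
    proof (intro equalityI subsetI)
      fix x assume "x \<in> {x. {v, x} \<in> edges ?G}"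
      then show "x \<in> ?N"
        unfolding E orig
        by (auto simp: doubleton_eq_iff vertex_eq_simps cycle_pred_succ)
    next
      \<comment> \<open>An edge to a predecessor is read as the successor edge of that predecessor,
        the form in which the edge families list it.\<close>
      have pr: "(cycle_pred p i + 1) mod p = i" "(cycle_pred q j + 1) mod q = j"
        using ij by (simp_all only: cycle_succ_eq_iff cycle_pred_less)
      fix x assume "x \<in> ?N"
      then consider "x = orig_vertex i ((j + 1) mod q)" | "x = orig_vertex i (cycle_pred q j)"
        | "x = edge_vertex p i j" | "x = edge_vertex p (cycle_pred p i) j" by blast
      then have "{v, x} \<in> edges ?G"
      proof cases
        case 1 then show ?thesis unfolding E orig using ij by blast
      next
        case 2
        then have "{v, x} = {orig_vertex i (cycle_pred q j), orig_vertex i ((cycle_pred q j + 1) mod q)}"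
          unfolding orig pr by auto
        then show ?thesis unfolding E using ij cycle_pred_less[of j q] by blast
      next
        case 3 then show ?thesis unfolding E orig using ij by blast
      next
        case 4
        then have "{v, x} = {orig_vertex ((cycle_pred p i + 1) mod p) j, edge_vertex p (cycle_pred p i) j}"
          unfolding orig pr by auto
        then show ?thesis unfolding E using ij cycle_pred_less[of i p] by blast
      qed
      then show "x \<in> {x. {v, x} \<in> edges ?G}" by simp
    qed
    moreover have "card ?N = 4"
      using cycle_succ_neq_pred[OF q ij(2)] cycle_succ_neq_pred[OF p ij(1)]
        edge_vertex_eq_iff[OF p ij(1) cycle_pred_less[OF ij(1)]]
      by (simp add: vertex_eq_simps)
    ultimately show ?thesis using degree_eq_card_neighbours[OF simple] by simp
  next
    case edge
    note ij = edge(2,3)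
    let ?N = "{orig_vertex i j, orig_vertex ((i + 1) mod p) j,
               edge_vertex p ((i + 1) mod p) j, edge_vertex p (cycle_pred p i) j}"
    have "{x. {v, x} \<in> edges ?G} = ?N"
    proof (intro equalityI subsetI)
      fix x assume "x \<in> {x. {v, x} \<in> edges ?G}"
      then consider i' j' where "{v, x} = {orig_vertex i' j', edge_vertex p i' j'}" "i' < p" "j' < q"
        | i' j' where "{v, x} = {orig_vertex ((i' + 1) mod p) j', edge_vertex p i' j'}" "i' < p" "j' < q"
        | i' j' where "{v, x} = {edge_vertex p i' j', edge_vertex p ((i' + 1) mod p) j'}" "i' < p" "j' < q"
        | i' j' where "{v, x} = {orig_vertex i' j', orig_vertex i' ((j' + 1) mod q)}"
        unfolding E by blast
      then show "x \<in> ?N"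
      proof cases
        case 1
        then show ?thesis unfolding edge
          by (auto simp: doubleton_eq_iff vertex_eq_simps edge_vertex_eq_iff[OF p] ij)
      next
        case 2
        then show ?thesis unfolding edge
          by (auto simp: doubleton_eq_iff vertex_eq_simps edge_vertex_eq_iff[OF p] ij)
      next
        case 3
        then have "edge_vertex p i j = edge_vertex p i' j' \<and> x = edge_vertex p ((i' + 1) mod p) j' \<or>
          edge_vertex p i j = edge_vertex p ((i' + 1) mod p) j' \<and> x = edge_vertex p i' j'"
          unfolding edge by (auto simp: doubleton_eq_iff)
        then have "i = i' \<and> j = j' \<and> x = edge_vertex p ((i' + 1) mod p) j' \<or>
          (i' + 1) mod p = i \<and> j = j' \<and> x = edge_vertex p i' j'"
          using edge_vertex_eq_iff[OF p ij(1) 3(2)] edge_vertex_eq_iff[OF p ij(1) s(1)] by metis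
        then show ?thesis using cycle_succ_eq_iff[OF ij(1) 3(2)] by auto
      next
        case 4
        then show ?thesis unfolding edge by (auto simp: doubleton_eq_iff vertex_eq_simps)
      qed
    next
      have pr: "(cycle_pred p i + 1) mod p = i"
        using ij by (simp_all only: cycle_succ_eq_iff cycle_pred_less)
      fix x assume "x \<in> ?N"
      then consider "{v, x} = {orig_vertex i j, edge_vertex p i j}"
        | "{v, x} = {orig_vertex ((i + 1) mod p) j, edge_vertex p i j}"
        | "{v, x} = {edge_vertex p i j, edge_vertex p ((i + 1) mod p) j}"
        | "{v, x} = {edge_vertex p (cycle_pred p i) j, edge_vertex p ((cycle_pred p i + 1) mod p) j}"
        unfolding edge pr by blast
      then have "{v, x} \<in> edges ?G"
        unfolding E using ij cycle_pred_less[of i p] by cases blast+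
      then show "x \<in> {x. {v, x} \<in> edges ?G}" by simp
    qed
    moreover have "card ?N = 4"
      using cycle_succ_neq_pred[OF p ij(1)]
        edge_vertex_eq_iff[OF p s(1) cycle_pred_less[OF ij(1)]]
      by (simp add: vertex_eq_simps)
    ultimately show ?thesis using degree_eq_card_neighbours[OF simple] by simp
  qed
qed

section \<open>Places inside a layer and positions on the spine\<close>

text \<open>Within a layer the spine order is \<open>v\<^sub>1, \<dots>, v\<^bsub>p-1\<^esub>, e\<^bsub>p-1\<^esub>, \<dots>, e\<^sub>0, v\<^sub>0\<close>,
  where \<open>e\<^sub>i\<close> joins \<open>i\<close> and \<open>i + 1\<close>.\<close>
definition orig_place :: "nat \<Rightarrow> nat \<Rightarrow> nat" where
  "orig_place p i = (if i = 0 then 2 * p - 1 else i - 1)"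

definition edge_place :: "nat \<Rightarrow> nat \<Rightarrow> nat" where
  "edge_place p i = 2 * p - 2 - i"

text \<open>An inserted vertex carries its edge as a set, so the index is recovered by
  \<open>THE\<close>; it is unique for \<open>p \<ge> 3\<close>.\<close>

definition Q_pos :: "nat \<Rightarrow> (nat + nat set) \<times> nat \<Rightarrow> nat" where
  "Q_pos p v = snake (2 * p) (snd v)
     (case fst v of Inl i \<Rightarrow> orig_place p i
      | Inr e \<Rightarrow> edge_place p (THE i. i < p \<and> e = cycle_edge p i))"

lemma place_less:
  assumes "i < p"
  shows "orig_place p i < 2 * p" "edge_place p i < 2 * p"
  using assms by (auto simp: orig_place_def edge_place_def)

lemma Q_pos_orig_vertex: "Q_pos p (orig_vertex i j) = snake (2 * p) j (orig_place p i)"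
  by (simp add: Q_pos_def orig_vertex_def)

lemma Q_pos_edge_vertex:
  assumes "p \<ge> 3" "i < p"
  shows "Q_pos p (edge_vertex p i j) = snake (2 * p) j (edge_place p i)"
proof -
  have "(THE i'. i' < p \<and> cycle_edge p i = cycle_edge p i') = i"
    using assms cycle_edge_eq_iff by (intro the_equality) auto
  then show ?thesis by (simp add: Q_pos_def edge_vertex_def)
qed

lemma bij_betw_Q_pos:
  fixes p q :: nat
  assumes p: "p \<ge> 3"
  defines "V \<equiv> verts (Q_sum (cycle_graph p) (cycle_graph q))"
  shows "bij_betw (Q_pos p) V {..<card V}"
proof -
  have V: "V = {orig_vertex i j | i j. i < p \<and> j < q} \<union> {edge_vertex p i j | i j. i < p \<and> j < q}"
    unfolding V_def by (rule verts_Q_sum_cycles)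
  note pos = Q_pos_orig_vertex Q_pos_edge_vertex[OF p]
  have inj: "inj_on (Q_pos p) V"
  proof (rule inj_onI)
    have place: "orig_place p i = orig_place p i' \<longleftrightarrow> i = i'" "edge_place p i = edge_place p i' \<longleftrightarrow> i = i'"
      "orig_place p i \<noteq> edge_place p i'" if "i < p" "i' < p" for i i'
      using that by (auto simp: orig_place_def edge_place_def)
    fix x y assume "x \<in> V" "y \<in> V" "Q_pos p x = Q_pos p y"
    then show "x = y"
      unfolding V by (auto simp: pos snake_eq_iff place_less place place(3)[symmetric])
  qed
  have img: "Q_pos p ` V = {..<2 * p * q}"
  proof (intro equalityI subsetI)
    fix n assume "n \<in> Q_pos p ` V"
    then obtain j k where n: "n = snake (2 * p) j k" "k < 2 * p" "j < q"
      unfolding V by (auto simp: pos place_less)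
    have "2 * p * (j + 1) \<le> 2 * p * q" using n(3) by (intro mult_le_mono) auto
    then show "n \<in> {..<2 * p * q}" using snake_bounds(2)[OF n(2), of j] n(1) by simp
  next
    fix n assume "n \<in> {..<2 * p * q}"
    then have j: "n div (2 * p) < q" using less_mult_imp_div_less[of n q "2 * p"] by (simp add: mult.commute)
    define r where "r = n mod (2 * p)"
    \<comment> \<open>Reflection is an involution, so reflecting the remainder in odd layers undoes
      the reversal made by \<open>snake\<close>.\<close>
    define k where "k = (if even (n div (2 * p)) then r else 2 * p - 1 - r)"
    have r: "r < 2 * p" using p by (simp add: r_def)
    then have k: "k < 2 * p" using p by (auto simp: k_def)
    have n: "n = snake (2 * p) (n div (2 * p)) k"
      using r by (auto simp: snake_def k_def) (simp_all add: r_def)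
    \<comment> \<open>The last place belongs to vertex 0, the first \<open>p - 1\<close> places to
      the other original vertices, and the \<open>p\<close> places between to the inserted
      ones.\<close>
    consider "k = 2 * p - 1" | "k < p - 1" | "p - 1 \<le> k" "k < 2 * p - 1" using k by linarith
    then have "(\<exists>i<p. k = orig_place p i) \<or> (\<exists>i<p. k = edge_place p i)"
    proof cases
      case 1
      then have "k = orig_place p 0" by (simp add: orig_place_def)
      moreover have "0 < p" using p by simp
      ultimately show ?thesis by blast
    next
      case 2
      then have "k = orig_place p (k + 1)" "k + 1 < p" by (simp_all add: orig_place_def)
      then show ?thesis by blast
    next
      case 3
      then have "k = edge_place p (2 * p - 2 - k)" "2 * p - 2 - k < p" by (simp_all add: edge_place_def)
      then show ?thesis by blast
    qed
    then show "n \<in> Q_pos p ` V"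
    proof (elim disjE exE conjE)
      fix i assume "i < p" "k = orig_place p i"
      then show ?thesis using n j unfolding V
        by (intro image_eqI[of _ _ "orig_vertex i (n div (2 * p))"]) (auto simp: pos)
    next
      fix i assume "i < p" "k = edge_place p i"
      then show ?thesis using n j unfolding V
        by (intro image_eqI[of _ _ "edge_vertex p i (n div (2 * p))"]) (auto simp: pos)
    qed
  qed
  have "card V = 2 * p * q" using card_image[OF inj] img by simp
  then show ?thesis using inj img by (simp add: bij_betw_def)
qed

section \<open>The five pages\<close>

text \<open>Page 4 takes two exceptional kinds of edges. The one from vertex 0 to the last inserted
  vertex would cross the arcs of page 2, and for odd \<open>p\<close> the link from inserted vertex
  0 to 1 would meet the link closing the cycle on page 0.\<close>

definition Q_page ::
    "nat \<Rightarrow> nat \<Rightarrow> nat \<Rightarrow> (((nat + nat set) \<times> nat) \<times> ((nat + nat set) \<times> nat)) set" where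
  "Q_page p q r =
     (if r < 2 then
        {(orig_vertex i j, orig_vertex i ((j + 1) mod q)) | i j. i < p \<and> j < q \<and> j mod 2 = r} \<union>
        {(edge_vertex p i j, edge_vertex p ((i + 1) mod p) j) | i j. 0 < i \<and> i < p \<and> j < q \<and> i mod 2 = r}
      else if r = 2 then {(orig_vertex (i + 1) j, edge_vertex p i j) | i j. i + 1 < p \<and> j < q}
      else if r = 3 then {(orig_vertex i j, edge_vertex p i j) | i j. i < p \<and> j < q}
      else {(orig_vertex 0 j, edge_vertex p (p - 1) j) | j. j < q} \<union>
           {(edge_vertex p 0 j, edge_vertex p 1 j) | j. j < q})"

lemma Q_page_cover:
  assumes p: "p \<ge> 3" and q: "q \<ge> 3"
    and e: "e \<in> edges (Q_sum (cycle_graph p) (cycle_graph q))"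
  shows "\<exists>r<5. \<exists>(x, y)\<in>Q_page p q r. e = {x, y}"
proof -
  have *: "\<exists>r<5. \<exists>(x, y)\<in>Q_page p q r. {x', y'} = {x, y}" if "r < 5" "(x', y') \<in> Q_page p q r" for r x' y'
    using that by blast
  from e consider
      i j where "e = {orig_vertex i j, orig_vertex i ((j + 1) mod q)}" "i < p" "j < q"
    | i j where "e = {orig_vertex i j, edge_vertex p i j}" "i < p" "j < q"
    | i j where "e = {orig_vertex ((i + 1) mod p) j, edge_vertex p i j}" "i < p" "j < q"
    | i j where "e = {edge_vertex p i j, edge_vertex p ((i + 1) mod p) j}" "i < p" "j < q"
    unfolding edges_Q_sum_cycles[OF p q] by blast
  then show ?thesis
  proof cases
    case 1
    then have "(orig_vertex i j, orig_vertex i ((j + 1) mod q)) \<in> Q_page p q (j mod 2)"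
      unfolding Q_page_def by auto
    moreover have "j mod 2 < 5" using mod_less_divisor[of 2 j] by linarith
    ultimately show ?thesis using * 1(1) by blast
  next
    case 2
    then have "(orig_vertex i j, edge_vertex p i j) \<in> Q_page p q 3"
      unfolding Q_page_def by auto
    then show ?thesis using *[of 3] 2(1) by simp
  next
    case 3
    show ?thesis
    proof (cases "i + 1 < p")
      case True
      then have "(orig_vertex ((i + 1) mod p) j, edge_vertex p i j) \<in> Q_page p q 2"
        using 3 unfolding Q_page_def by auto
      then show ?thesis using *[of 2] 3(1) by simp
    next
      case False
      then have "i = p - 1" "(i + 1) mod p = 0" using 3 by (auto simp: mod_Suc)
      then have "(orig_vertex ((i + 1) mod p) j, edge_vertex p i j) \<in> Q_page p q 4"
        using 3 unfolding Q_page_def by auto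
      then show ?thesis using *[of 4] 3(1) by simp
    qed
  next
    case 4
    show ?thesis
    proof (cases "i = 0")
      case True
      then have "(edge_vertex p i j, edge_vertex p ((i + 1) mod p) j) \<in> Q_page p q 4"
        using 4 p unfolding Q_page_def by auto
      then show ?thesis using *[of 4] 4(1) by simp
    next
      case False
      then have "(edge_vertex p i j, edge_vertex p ((i + 1) mod p) j) \<in> Q_page p q (i mod 2)"
        using 4 unfolding Q_page_def by auto
      moreover have "i mod 2 < 5" using mod_less_divisor[of 2 i] by linarith
      ultimately show ?thesis using * 4(1) by blast
    qed
  qed
qed

lemma Q_page_compatible:
  assumes p: "p \<ge> 3" and q: "even q"
    and xy: "(x, y) \<in> Q_page p q r" and zw: "(z, w) \<in> Q_page p q r"
  shows "arcs_compatible (Q_pos p x) (Q_pos p y) (Q_pos p z) (Q_pos p w)"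
proof -
  note pos = Q_pos_orig_vertex Q_pos_edge_vertex[OF p]
  note intra = arcs_compatible_snake_intra[of _ "2 * p"]
  consider "r < 2" | "r = 2" | "r = 3" | "r > 3" by linarith
  then show ?thesis
  proof cases
    case 1
    let ?inter = "\<lambda>x y. \<exists>i j. i < p \<and> j < q \<and> j mod 2 = r \<and> x = orig_vertex i j \<and> y = orig_vertex i ((j + 1) mod q)"
    let ?intra = "\<lambda>x y. \<exists>i j. 0 < i \<and> i < p \<and> i mod 2 = r \<and> x = edge_vertex p i j \<and> y = edge_vertex p ((i + 1) mod p) j"
    have page: "?inter x y \<or> ?intra x y" if "(x, y) \<in> Q_page p q r" for x y
      using that 1 unfolding Q_page_def by auto
    have s: "(i + 1) mod p < p" for i using p by auto
    have inter_intra: "arcs_compatible (Q_pos p x) (Q_pos p y) (Q_pos p z) (Q_pos p w)"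
      if "?inter x y" "?intra z w" for x y z w
    proof -
      from that obtain i j i' j' where h: "i < p" "x = orig_vertex i j" "y = orig_vertex i ((j + 1) mod q)"
        "i' < p" "z = edge_vertex p i' j'" "w = edge_vertex p ((i' + 1) mod p) j'" by blast
      \<comment> \<open>Within a layer the inserted vertices occupy an interval of places, so no
        original vertex lies between two of them.\<close>
      have out: "\<not> (edge_place p k \<le> orig_place p i \<and> orig_place p i \<le> edge_place p k')"
        if "k < p" for k k'
        using h(1) that by (auto simp: orig_place_def edge_place_def)
      show ?thesis
        unfolding h(2,3,5,6) pos(1) pos(2)[OF h(4)] pos(2)[OF s]
        using out[OF h(4)] out[OF s[of i']] h(1,4) s
        by (intro arcs_compatible_snake_inter_intra place_less) (auto simp: min_def max_def)
    qed
    show ?thesis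
    proof (cases "?inter x y"; cases "?inter z w")
      assume "?inter x y" "?inter z w"
      then obtain i j i' j' where h: "i < p" "j < q" "x = orig_vertex i j" "y = orig_vertex i ((j + 1) mod q)"
        "i' < p" "j' < q" "z = orig_vertex i' j'" "w = orig_vertex i' ((j' + 1) mod q)"
        and "j mod 2 = j' mod 2" by metis
      then have "even j = even j'" by (metis even_iff_mod_2_eq_zero)
      then show ?thesis
        unfolding h(3,4,7,8) pos(1)
        using q h by (intro arcs_compatible_snake_inter place_less)
    next
      assume "?inter x y" "\<not> ?inter z w"
      then show ?thesis using inter_intra page[OF zw] by blast
    next
      assume "\<not> ?inter x y" "?inter z w"
      then show ?thesis using inter_intra page[OF xy] by (blast intro: arcs_compatible_sym)
    next
      assume "\<not> ?inter x y" "\<not> ?inter z w"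
      then have "?intra x y" "?intra z w" using page xy zw by blast+
      then obtain i j i' j' where h: "0 < i" "i < p" "x = edge_vertex p i j" "y = edge_vertex p ((i + 1) mod p) j"
        "0 < i'" "i' < p" "z = edge_vertex p i' j'" "w = edge_vertex p ((i' + 1) mod p) j'"
        and par: "i mod 2 = i' mod 2" by metis
      have "arcs_compatible (edge_place p i) (edge_place p ((i + 1) mod p))
              (edge_place p i') (edge_place p ((i' + 1) mod p))"
      proof -
        \<comment> \<open>Links between neighbouring places are side by side. The link with
          \<open>i' = p - 1\<close> joins the extreme inserted places \<open>p - 1\<close> and
          \<open>2 * p - 2\<close>; \<open>0 < i\<close> and \<open>i + 1 < i'\<close> keep the
          other link off both, so it is enclosed.\<close>
        have less: "arcs_compatible (edge_place p i) (edge_place p ((i + 1) mod p))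
              (edge_place p i') (edge_place p ((i' + 1) mod p))"
          if "0 < i" "i + 1 < i'" "i' < p" for i i'
        proof (cases "i' + 1 = p")
          case True
          then have "edge_place p i = 2 * p - 2 - i" "edge_place p ((i + 1) mod p) = 2 * p - 3 - i"
            "edge_place p i' = p - 1" "edge_place p ((i' + 1) mod p) = 2 * p - 2"
            using that by (simp_all add: edge_place_def)
          moreover have "p - 1 < 2 * p - 3 - i" "p - 1 < 2 * p - 2 - i"
            "2 * p - 2 - i < 2 * p - 2" "2 * p - 3 - i < 2 * p - 2" using that True by linarith+
          ultimately show ?thesis by (simp add: arcs_compatible_def)
        next
          case False
          then have "edge_place p i = 2 * p - 2 - i" "edge_place p ((i + 1) mod p) = 2 * p - 3 - i"
            "edge_place p i' = 2 * p - 2 - i'" "edge_place p ((i' + 1) mod p) = 2 * p - 3 - i'"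
            using that by (simp_all add: edge_place_def)
          moreover have "2 * p - 2 - i' < 2 * p - 3 - i" "2 * p - 3 - i' < 2 * p - 3 - i"
            "2 * p - 2 - i' < 2 * p - 2 - i" "2 * p - 3 - i' < 2 * p - 2 - i" using that by linarith+
          ultimately show ?thesis by (simp add: arcs_compatible_def)
        qed
        \<comment> \<open>Equal parity excludes consecutive indices, whose links would share a
          vertex.\<close>
        have "i = i' \<or> i + 1 < i' \<or> i' + 1 < i" using par by presburger
        then consider "i = i'" | "i + 1 < i'" | "i' + 1 < i" by blast
        then show ?thesis
        proof cases
          case 1
          then show ?thesis by (simp add: arcs_compatible_def)
        next
          case 2
          then show ?thesis using h by (intro less)
        next
          case 3
          then show ?thesis using h by (intro arcs_compatible_sym[OF less])
        qed
      qed
      then show ?thesis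
        unfolding h(3,4,7,8) pos(2)[OF h(2)] pos(2)[OF h(6)] pos(2)[OF s]
        using h(2,6) s by (intro intra place_less)
    qed
  next
    case 2
    then obtain i j i' j' where h: "x = orig_vertex (i + 1) j" "y = edge_vertex p i j" "i + 1 < p"
      "z = orig_vertex (i' + 1) j'" "w = edge_vertex p i' j'" "i' + 1 < p"
      using xy zw unfolding Q_page_def by auto
    then have lt: "i < p" "i' < p" by auto
    \<comment> \<open>The places \<open>i\<close> and \<open>2 * p - 2 - i\<close> have a constant
      sum, so these arcs are concentric.\<close>
    have "arcs_compatible (orig_place p (i + 1)) (edge_place p i) (orig_place p (i' + 1)) (edge_place p i')"
      by (rule arcs_compatible_nested) (use h in \<open>auto simp: orig_place_def edge_place_def\<close>)
    then show ?thesis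
      unfolding h(1,2,4,5) pos(1) pos(2)[OF lt(1)] pos(2)[OF lt(2)]
      using lt h(3,6) by (intro intra place_less)
  next
    case 3
    then obtain i j i' j' where h: "x = orig_vertex i j" "y = edge_vertex p i j" "i < p"
      "z = orig_vertex i' j'" "w = edge_vertex p i' j'" "i' < p"
      using xy zw unfolding Q_page_def by auto
    have "arcs_compatible (orig_place p i) (edge_place p i) (orig_place p i') (edge_place p i')"
    proof -
      \<comment> \<open>For positive index the places \<open>i - 1\<close> and
        \<open>2 * p - 2 - i\<close> are again concentric. Index 0 is exceptional: its arc joins the
        last two places, to the right of all the others.\<close>
      have zero: "arcs_compatible (orig_place p 0) (edge_place p 0) (orig_place p k) (edge_place p k)"
        if "0 < k" "k < p" for k
      proof -
        have "orig_place p k < orig_place p 0" "orig_place p k < edge_place p 0"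
          "edge_place p k < orig_place p 0" "edge_place p k < edge_place p 0"
          using that by (simp_all add: orig_place_def edge_place_def)
        then show ?thesis by (simp add: arcs_compatible_def)
      qed
      consider "i = 0" "i' = 0" | "i = 0" "0 < i'" | "0 < i" "i' = 0" | "0 < i" "0 < i'" by auto
      then show ?thesis
      proof cases
        case 1
        then show ?thesis by (simp add: arcs_compatible_def)
      next
        case 2
        then show ?thesis using zero h(6) by simp
      next
        case 3
        then show ?thesis using zero h(3) arcs_compatible_sym by simp
      next
        case 4
        then show ?thesis
          using h(3,6) by (intro arcs_compatible_nested; simp add: orig_place_def edge_place_def; linarith)
      qed
    qed
    then show ?thesis
      unfolding h(1,2,4,5) pos(1) pos(2)[OF h(3)] pos(2)[OF h(6)]
      using h(3,6) by (intro intra place_less)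
  next
    case 4
    have lt: "0 < p" "1 < p" "p - 1 < p" using p by auto
    have page: "\<exists>j. Q_pos p x = snake (2 * p) j (2 * p - 1) \<and> Q_pos p y = snake (2 * p) j (p - 1) \<or>
        Q_pos p x = snake (2 * p) j (2 * p - 2) \<and> Q_pos p y = snake (2 * p) j (2 * p - 3)"
      if xy: "(x, y) \<in> Q_page p q r" for x y
    proof -
      have "(\<exists>j. x = orig_vertex 0 j \<and> y = edge_vertex p (p - 1) j) \<or>
            (\<exists>j. x = edge_vertex p 0 j \<and> y = edge_vertex p 1 j)"
        using xy 4 unfolding Q_page_def by auto
      moreover have "orig_place p 0 = 2 * p - 1" "edge_place p (p - 1) = p - 1"
        "edge_place p 0 = 2 * p - 2" "edge_place p 1 = 2 * p - 3"
        using p by (auto simp: orig_place_def edge_place_def)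
      ultimately show ?thesis using pos(1) pos(2)[OF lt(1)] pos(2)[OF lt(2)] pos(2)[OF lt(3)] by metis
    qed
    \<comment> \<open>The short arc lies inside the long one; \<open>p - 1 < 2 * p - 3\<close> is
      where \<open>p \<ge> 3\<close> enters.\<close>
    have "p - 1 < 2 * p - 2" "p - 1 < 2 * p - 3" "2 * p - 2 < 2 * p - 1" "2 * p - 3 < 2 * p - 1"
      using p by linarith+
    then have c: "arcs_compatible (2 * p - 1) (p - 1) (2 * p - 2) (2 * p - 3)"
      by (simp add: arcs_compatible_def)
    note c = c arcs_compatible_sym[OF c]
    have same: "arcs_compatible a b a b" for a b
      by (simp add: arcs_compatible_def)
    have lt': "2 * p - 1 < 2 * p" "p - 1 < 2 * p" "2 * p - 2 < 2 * p" "2 * p - 3 < 2 * p" using p by auto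
    from page[OF xy] page[OF zw] show ?thesis
      by (elim exE disjE conjE; simp only:) (intro intra lt' c same)+
  qed
qed

theorem theorem3p5:
  fixes p q :: nat
  assumes "p \<ge> 3" and "q \<ge> 4" and "even q"
  shows "nearly_dispersable (Q_sum (cycle_graph p) (cycle_graph q))
       \<and> max_degree (Q_sum (cycle_graph p) (cycle_graph q)) = 4
       \<and> mbt (Q_sum (cycle_graph p) (cycle_graph q)) = 5"
proof -
  let ?G = "Q_sum (cycle_graph p) (cycle_graph q)"
  have q: "q \<ge> 3" using assms by simp
  note E = edges_Q_sum_cycles[OF assms(1) q]
  have simple: "simple_graph ?G"
    using assms(1) q by (intro simple_graph_Q_sum simple_graph_cycle_graph)
  have deg: "degree ?G v = 4" if "v \<in> verts ?G" for v
    using degree_Q_sum_cycles[OF assms(1) q that] .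
  have "0 < p" "0 < q" using assms by simp_all
  then have "orig_vertex 0 0 \<in> verts ?G" unfolding verts_Q_sum_cycles by blast
  then have "degree ?G ` verts ?G = {4}"
    using deg by (intro equalityI subsetI) (auto intro: rev_image_eqI)
  then have max: "max_degree ?G = 4" by (simp add: max_degree_def)
  have "\<exists>page. matching_book_embedding ?G 5 (Q_pos p) page"
    using assms q
    by (intro matching_book_embeddingI[where P = "Q_page p q"] simple bij_betw_Q_pos Q_page_cover
        Q_page_compatible)
  moreover have "5 \<le> n" if "\<exists>pos page. matching_book_embedding ?G n pos page" for n
  proof -
    from that obtain pos page where M: "matching_book_embedding ?G n pos page" by blast
    \<comment> \<open>Edges 0 and 1 of the cycle meet in vertex 1, so this vertex and the two
      inserted ones form a triangle in layer 0.\<close>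
    let ?x = "orig_vertex 1 0" and ?y = "edge_vertex p 0 0" and ?z = "edge_vertex p 1 0"
    have ij: "0 < p" "1 < p" "0 < q" "(0 + 1) mod p = 1" using assms by auto
    have "{orig_vertex ((0 + 1) mod p) 0, ?y} \<in> edges ?G"
      "{?y, edge_vertex p ((0 + 1) mod p) 0} \<in> edges ?G" "{?x, ?z} \<in> edges ?G"
      unfolding E using ij(1-3) by blast+
    then have "4 < n"
      unfolding ij(4) by (intro triangle_full_degree_less_pages[OF simple M deg])
    then show ?thesis by simp
  qed
  ultimately have "mbt ?G = 5"
    unfolding mbt_def by (intro Least_equality) blast+
  then show ?thesis using max by (simp add: nearly_dispersable_def)
qed

end
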